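(* Consider the double integrator $\dot x_p=x_v$, $\dot x_v=u$ with state $x=(x_p,x_v)\in\mathbb{R}^{2d}$ and control $u\in\mathbb{R}^d$, the storage function $V(x)=\frac{k_v}{2}x_v^{\mathrm T}x_v$ with $k_v$ a positive constant, and the energy tank with state $E\in\mathbb{R}$ and dynamics $\dot E=\varepsilon$, where $\varepsilon\in\mathbb{R}$ is an additional control. Let $F(t)\in\mathbb{R}^d$ be the force-feedback signal and $x_{vd}(t)\in\mathbb{R}^d$ the desired-velocity signal. If the two conditions $$\frac{k}{2}\|F\|^2+\varepsilon=\frac{1}{2k}\|x_{vd}\|^2-\dot V(u,x)\qquad\text{and}\qquad \varepsilon\ge-\frac{E}{\Delta_t}$$ are satisfied for every $t\ge 0$, then the signals $F$ (as output) and $x_{vd}$ (as input) satisfy the definition of $\mathcal{L}_2$-gain with $\gamma=\frac{1}{k^2}$ and $\beta=\frac{2}{k}V(0)+E(0)$, that is, $$\|F\|_2\le\frac{1}{k^2}\,\|x_{vd}\|_2+\frac{2}{k}V(0)+E(0),$$ where $V(0)$ is the initial energy of the system and $E(0)$ is the initial energy of the energy tank.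
   Context: Definition ($\mathcal{L}_2$-gain): a map $u(t)\mapsto y(t)$ between two signals has $\mathcal{L}_2$-gain $\gamma\ge 0$ if there exists a constant $\beta\in\mathbb{R}$ such that $\|y\|_2\le\gamma\|u\|_2+\beta$, where $\|\cdot\|_2$ is the $L^2$ norm of a signal in time; $\|\cdot\|$ without subscript is the Euclidean norm on $\mathbb{R}^d$. Here $x_p$ and $x_v$ are the position and velocity of a quadrotor, $u$ is its acceleration command, $x_{vd}$ is the velocity desired by the human user, $F$ is the force rendered to the user, $V$ represents the mechanical energy stored in the system, $\dot V(u,x)=k_v x_v^{\mathrm T}u$ is its time derivative along the dynamics, $V(0)$ is the value of $V$ at time $0$, $E$ is the energy stored in an auxiliary energy tank and $\varepsilon$ is the energy flow of the tank. The parameter $k$ is a constant that sets the gain, and $\Delta_t$ is a time constant (the duration for which a control is applied).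
   Formalization: The displayed inequality is false as written; proved instead for k>0: ‖F‖₂² ≤ (1/k²)‖x_vd‖₂² + (2/k)(V(0)+E(0)), and the L2-gain definition with γ = 1/k and β = sqrt((2/k)·max(0, V(0)+E(0))). *)

theory Defs
  imports "HOL-Analysis.Analysis"
begin

text \<open>Signals are functions of time restricted to \<open>[0, \<infinity>)\<close>. A signal lies in \<open>L\<^sup>2\<close> if it is
  measurable and square integrable there; \<open>L2_norm\<close> is only meaningful for such signals.\<close>

definition L2_signal :: "(real \<Rightarrow> 'a::real_normed_vector) \<Rightarrow> bool" where
  "L2_signal y \<longleftrightarrow> y \<in> borel_measurable (lebesgue_on {0..}) \<and>
     integrable (lebesgue_on {0..}) (\<lambda>t. (norm (y t))\<^sup>2)"

definition L2_norm :: "(real \<Rightarrow> 'a::real_normed_vector) \<Rightarrow> real" where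
  "L2_norm y = sqrt (integral\<^sup>L (lebesgue_on {0..}) (\<lambda>t. (norm (y t))\<^sup>2))"

text \<open>In both definitions below \<open>u\<close> is the input and \<open>y\<close> the output. If \<open>u\<close> is not in \<open>L\<^sup>2\<close>, its
  norm is infinite and the inequality imposes nothing; if \<open>u\<close> is in \<open>L\<^sup>2\<close>, then the inequality
  includes finiteness of the norm of \<open>y\<close>.\<close>

definition has_L2_gain ::
  "(real \<Rightarrow> 'a::real_normed_vector) \<Rightarrow> (real \<Rightarrow> 'b::real_normed_vector) \<Rightarrow> real \<Rightarrow> real \<Rightarrow> bool" where
  "has_L2_gain u y \<gamma> \<beta> \<longleftrightarrow> 0 \<le> \<gamma> \<and>
     (L2_signal u \<longrightarrow> L2_signal y \<and> L2_norm y \<le> \<gamma> * L2_norm u + \<beta>)"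

text \<open>The same notion with \<open>\<parallel>\<cdot>\<parallel>\<^sub>2\<close> replaced by the signal energy, the square of the \<open>L\<^sup>2\<close> norm.\<close>

definition has_L2_energy_gain ::
  "(real \<Rightarrow> 'a::real_normed_vector) \<Rightarrow> (real \<Rightarrow> 'b::real_normed_vector) \<Rightarrow> real \<Rightarrow> real \<Rightarrow> bool" where
  "has_L2_energy_gain u y \<gamma> \<beta> \<longleftrightarrow> 0 \<le> \<gamma> \<and>
     (L2_signal u \<longrightarrow> L2_signal y \<and> (L2_norm y)\<^sup>2 \<le> \<gamma> * (L2_norm u)\<^sup>2 + \<beta>)"

text \<open>\<open>solves_ode z f\<close>: \<open>z\<close> is a solution of \<open>z' = f t\<close> on \<open>[0, \<infinity>)\<close>. Besides classical solutions,
  this admits controls that jump, e.g. ones held constant over sampling periods: the derivative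
  may fail at switching times, of which there are finitely many in every bounded interval.\<close>

definition solves_ode :: "(real \<Rightarrow> 'a::real_normed_vector) \<Rightarrow> (real \<Rightarrow> 'a) \<Rightarrow> bool" where
  "solves_ode z f \<longleftrightarrow> continuous_on {0..} z \<and>
     (\<exists>S. (\<forall>T. finite (S \<inter> {0..T})) \<and>
          (\<forall>t\<in>{0..} - S. (z has_vector_derivative f t) (at t within {0..})))"

text \<open>States are pairs \<open>(x\<^sub>p, x\<^sub>v)\<close> of position and velocity.\<close>

definition double_integrator ::
  "(real^'d) \<times> (real^'d) \<Rightarrow> real^'d \<Rightarrow> (real^'d) \<times> (real^'d)" where
  "double_integrator x u = (snd x, u)"

definition storage :: "real \<Rightarrow> (real^'d) \<times> (real^'d) \<Rightarrow> real" where
  "storage k\<^sub>v x = k\<^sub>v / 2 * (snd x \<bullet> snd x)"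

definition storage_rate :: "real \<Rightarrow> real^'d \<Rightarrow> (real^'d) \<times> (real^'d) \<Rightarrow> real" where
  "storage_rate k\<^sub>v u x = k\<^sub>v * (snd x \<bullet> u)"

lemma storage_has_derivative_along_dynamics:
  assumes "(x has_vector_derivative double_integrator (x t) u) (at t within A)"
  shows "((\<lambda>s. storage k\<^sub>v (x s)) has_real_derivative storage_rate k\<^sub>v u (x t)) (at t within A)"
proof -
  have "((\<lambda>s. snd (x s)) has_vector_derivative u) (at t within A)"
    using bounded_linear.has_vector_derivative[OF bounded_linear_snd assms]
    by (simp add: double_integrator_def)
  then have "((\<lambda>s. snd (x s)) has_derivative (\<lambda>h. h *\<^sub>R u)) (at t within A)"
    by (simp add: has_vector_derivative_def)
  then have "((\<lambda>s. storage k\<^sub>v (x s)) has_derivative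
      (\<lambda>h. k\<^sub>v / 2 * (snd (x t) \<bullet> (h *\<^sub>R u) + (h *\<^sub>R u) \<bullet> snd (x t)))) (at t within A)"
    unfolding storage_def
    by (intro has_derivative_mult_right has_derivative_inner)
  then show ?thesis
    unfolding has_field_derivative_def
    by (rule has_derivative_eq_rhs) (auto simp: storage_rate_def inner_commute)
qed

end

theory Submission
  imports Defs "HOL-Real_Asymp.Real_Asymp"
begin

text \<open>The balance condition says that the total energy \<open>W = V + E\<close> has derivative
  \<open>\<parallel>x_vd\<parallel>\<^sup>2 / (2 k) - k \<parallel>F\<parallel>\<^sup>2 / 2\<close>, so the energy of \<open>F\<close> on \<open>[0, T]\<close> is controlled by that of
  \<open>x_vd\<close> and by \<open>W 0 - W T\<close>. The tank condition makes \<open>exp (t / \<Delta>\<^sub>t) * E t\<close> nondecreasing,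
  hence \<open>W T \<ge> E 0 * exp (- T / \<Delta>\<^sub>t)\<close>. This lower bound tends to 0 even when \<open>E 0 < 0\<close>, and
  letting \<open>T\<close> tend to infinity gives the energy estimate.\<close>

text \<open>The fundamental theorem of calculus tolerates finitely many exceptional points if the
  primitive is continuous. Integrability of \<open>f\<close> on \<open>{0..T}\<close> is part of the
  conclusion.\<close>

lemma solves_ode_has_integral:
  fixes z :: "real \<Rightarrow> 'a::banach"
  assumes "solves_ode z f" and "0 \<le> T"
  shows "(f has_integral (z T - z 0)) {0..T}"
proof -
  obtain S where cont: "continuous_on {0..} z" and fin: "finite (S \<inter> {0..T})"
    and deriv: "\<And>t. t \<in> {0..} - S \<Longrightarrow> (z has_vector_derivative f t) (at t within {0..})"
    using assms(1) unfolding solves_ode_def by blast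
  \<comment> \<open>Away from the endpoints the one-sided filter of \<open>solves_ode\<close> is the
    full neighbourhood filter.\<close>
  have "(z has_vector_derivative f t) (at t)" if "t \<in> {0<..<T} - S \<inter> {0..T}" for t
    using deriv[of t] that at_within_interior[of t "{0..}"] by auto
  moreover have "continuous_on {0..T} z"
    using cont by (rule continuous_on_subset) auto
  ultimately show ?thesis
    using fundamental_theorem_of_calculus_interior_strong[OF fin assms(2)] by blast
qed

lemma solves_ode_add:
  assumes "solves_ode z f" and "solves_ode w g"
  shows "solves_ode (\<lambda>t. z t + w t) (\<lambda>t. f t + g t)"
proof -
  obtain S where S: "\<And>T. finite (S \<inter> {0..T})"
    "\<And>t. t \<in> {0..} - S \<Longrightarrow> (z has_vector_derivative f t) (at t within {0..})"
    using assms(1) unfolding solves_ode_def by blast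
  obtain S' where S': "\<And>T. finite (S' \<inter> {0..T})"
    "\<And>t. t \<in> {0..} - S' \<Longrightarrow> (w has_vector_derivative g t) (at t within {0..})"
    using assms(2) unfolding solves_ode_def by blast
  have "continuous_on {0..} (\<lambda>t. z t + w t)"
    using assms unfolding solves_ode_def by (blast intro: continuous_on_add)
  moreover have "finite ((S \<union> S') \<inter> {0..T})" for T
    using S(1) S'(1) by (simp add: Int_Un_distrib2)
  moreover have "((\<lambda>t. z t + w t) has_vector_derivative f t + g t) (at t within {0..})"
    if "t \<in> {0..} - (S \<union> S')" for t
    using that S(2) S'(2) by (auto intro: has_vector_derivative_add)
  ultimately show ?thesis
    unfolding solves_ode_def by blast
qed

lemma solves_ode_storage:
  assumes "solves_ode x (\<lambda>t. double_integrator (x t) (u t))"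
  shows "solves_ode (\<lambda>t. storage c (x t)) (\<lambda>t. storage_rate c (u t) (x t))"
proof -
  have cont: "continuous_on {0..} x"
    using assms unfolding solves_ode_def by blast
  have "continuous_on {0..} (\<lambda>t. storage c (x t))"
    unfolding storage_def by (intro continuous_intros cont)
  moreover have "((\<lambda>t. storage c (x t)) has_vector_derivative storage_rate c (u t) (x t))
      (at t within {0..})"
    if "(x has_vector_derivative double_integrator (x t) (u t)) (at t within {0..})" for t
    using storage_has_derivative_along_dynamics[OF that]
    by (simp add: has_real_derivative_iff_has_vector_derivative)
  ultimately show ?thesis
    using assms unfolding solves_ode_def by blast
qed

text \<open>\<open>exp (t / \<tau>)\<close> is the integrating factor of the extremal tank equation
  \<open>E' = - E / \<tau>\<close>.\<close>

lemma solves_ode_exp_weight: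
  fixes E \<epsilon> :: "real \<Rightarrow> real"
  assumes "solves_ode E \<epsilon>"
  shows "solves_ode (\<lambda>t. exp (t / \<tau>) * E t) (\<lambda>t. exp (t / \<tau>) * (\<epsilon> t + E t / \<tau>))"
proof -
  have cont: "continuous_on {0..} E"
    using assms unfolding solves_ode_def by blast
  have "continuous_on {0..} (\<lambda>t. exp (t / \<tau>) * E t)"
    unfolding divide_inverse by (intro continuous_intros cont)
  moreover have "((\<lambda>t. exp (t / \<tau>) * E t) has_vector_derivative exp (t / \<tau>) * (\<epsilon> t + E t / \<tau>))
      (at t within {0..})" if "(E has_vector_derivative \<epsilon> t) (at t within {0..})" for t
    using that unfolding has_real_derivative_iff_has_vector_derivative[symmetric] divide_inverse
    by (auto intro!: derivative_eq_intros simp: algebra_simps)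
  ultimately show ?thesis
    using assms unfolding solves_ode_def by blast
qed

text \<open>A Gronwall-type comparison with the tank that drains at the maximal admissible rate from
  the same initial energy, whatever the sign of \<open>E 0\<close>.\<close>

lemma energy_tank_lower_bound:
  fixes E \<epsilon> :: "real \<Rightarrow> real"
  assumes "solves_ode E \<epsilon>" and "\<And>t. 0 \<le> t \<Longrightarrow> - E t / \<tau> \<le> \<epsilon> t" and "0 \<le> T"
  shows "E 0 * exp (- T / \<tau>) \<le> E T"
proof -
  have "((\<lambda>t. exp (t / \<tau>) * (\<epsilon> t + E t / \<tau>)) has_integral
      exp (T / \<tau>) * E T - exp (0 / \<tau>) * E 0) {0..T}"
    by (rule solves_ode_has_integral[OF solves_ode_exp_weight[OF assms(1)] assms(3)])
  moreover have "0 \<le> exp (t / \<tau>) * (\<epsilon> t + E t / \<tau>)" if "t \<in> {0..T}" for t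
    using assms(2)[of t] that by simp
  ultimately have "0 \<le> exp (T / \<tau>) * E T - exp (0 / \<tau>) * E 0"
    by (rule has_integral_nonneg)
  then show ?thesis
    by (simp add: exp_minus field_simps)
qed

text \<open>Monotone convergence of the truncations to \<open>{0..n}\<close>. The bound
  \<open>b n\<close> may vary with \<open>n\<close>, since the tank estimate contains a decaying
  term.\<close>

lemma integrable_half_line_nonneg:
  fixes f :: "real \<Rightarrow> real"
  assumes nonneg: "\<And>t. 0 \<le> t \<Longrightarrow> 0 \<le> f t"
    and int: "\<And>n. f integrable_on {0..real n}"
    and le: "\<And>n. integral {0..real n} f \<le> b n"
    and lim: "b \<longlonglongrightarrow> B"
  shows "integrable (lebesgue_on {0..}) f" and "integral\<^sup>L (lebesgue_on {0..}) f \<le> B"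
proof -
  \<comment> \<open>Extension by zero puts all truncations on the common domain
    \<open>{0..}\<close>.\<close>
  define g where "g n t = (if t \<in> {0..real n} then f t else 0)" for n t
  have g_int: "g n integrable_on {0..}" and g_eq: "integral {0..} (g n) = integral {0..real n} f" for n
  proof -
    have *: "{0..real n} \<subseteq> {0..}" by auto
    show "g n integrable_on {0..}"
      unfolding g_def using integrable_restrict_Int[of "{0..real n}" f "{0..}"] int[of n] *
      by (simp add: inf.absorb1)
    show "integral {0..} (g n) = integral {0..real n} f"
      unfolding g_def using integral_restrict_Int[of "{0..}" "{0..real n}" f] *
      by (simp add: inf.absorb1)
  qed
  have conv: "f integrable_on {0..} \<and> (\<lambda>n. integral {0..} (g n)) \<longlonglongrightarrow> integral {0..} f"
  proof (rule monotone_convergence_increasing)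
    show "g n t \<le> g (Suc n) t" if "t \<in> {0..}" for n t
      using nonneg that by (auto simp: g_def)
    show "(\<lambda>n. g n t) \<longlonglongrightarrow> f t" if "t \<in> {0..}" for t
    proof (rule tendsto_eventually)
      have "eventually (\<lambda>n. t \<le> real n) sequentially"
        using filterlim_real_sequentially unfolding filterlim_at_top by blast
      then show "eventually (\<lambda>n. g n t = f t) sequentially"
        by eventually_elim (use that in \<open>simp add: g_def\<close>)
    qed
    \<comment> \<open>A convergent \<open>b\<close> is bounded, which bounds the integrals from
      above; nonnegativity bounds them from below.\<close>
    obtain K where K: "\<And>n. norm (b n) \<le> K"
      using convergent_imp_Bseq[of b] lim unfolding convergent_def Bseq_def by blast
    have "\<bar>integral {0..} (g n)\<bar> \<le> K" for n
      using K[of n] le[of n] integral_nonneg[OF int[of n]] nonneg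
      by (simp add: g_eq)
    then show "bounded (range (\<lambda>n. integral {0..} (g n)))"
      by (auto simp: bounded_iff)
  qed (rule g_int)
  \<comment> \<open>For nonnegative \<open>f\<close> gauge integrability is already Lebesgue
    integrability.\<close>
  then have "f absolutely_integrable_on {0..}"
    using nonneg by (auto intro: nonnegative_absolutely_integrable_1)
  then show integrable: "integrable (lebesgue_on {0..}) f"
    by (simp add: integrable_restrict_space set_integrable_def)
  have "integral {0..} f \<le> B"
    using conv lim le by (intro LIMSEQ_le[of _ _ b]) (auto simp: g_eq)
  then show "integral\<^sup>L (lebesgue_on {0..}) f \<le> B"
    using lebesgue_integral_eq_integral[OF integrable] by simp
qed

lemma L2_norm_power2:
  "(L2_norm y)\<^sup>2 = integral\<^sup>L (lebesgue_on {0..}) (\<lambda>t. (norm (y t))\<^sup>2)"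
  by (simp add: L2_norm_def)

lemma L2_norm_nonneg: "0 \<le> L2_norm y"
  by (simp add: L2_norm_def)

text \<open>Take roots and use subadditivity of \<open>sqrt\<close>. The offset
  \<open>\<beta>\<close> is first raised to \<open>max 0 \<beta>\<close>, as it may be
  negative.\<close>

lemma L2_energy_gain_imp_L2_gain:
  assumes "has_L2_energy_gain u y (\<gamma>\<^sup>2) \<beta>" and "0 \<le> \<gamma>"
  shows "has_L2_gain u y \<gamma> (sqrt (max 0 \<beta>))"
proof -
  have "L2_norm y \<le> \<gamma> * L2_norm u + sqrt (max 0 \<beta>)"
    if "(L2_norm y)\<^sup>2 \<le> \<gamma>\<^sup>2 * (L2_norm u)\<^sup>2 + \<beta>"
  proof -
    have "L2_norm y \<le> sqrt ((\<gamma> * L2_norm u)\<^sup>2 + max 0 \<beta>)"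
      using that by (intro real_le_rsqrt) (simp add: power_mult_distrib)
    also have "\<dots> \<le> sqrt ((\<gamma> * L2_norm u)\<^sup>2) + sqrt (max 0 \<beta>)"
      by (rule sqrt_add_le_add_sqrt) auto
    also have "\<dots> = \<gamma> * L2_norm u + sqrt (max 0 \<beta>)"
      using assms(2) L2_norm_nonneg[of u] by simp
    finally show ?thesis .
  qed
  then show ?thesis
    using assms unfolding has_L2_energy_gain_def has_L2_gain_def by blast
qed

text \<open>The balance relates squared norms, so \<open>1 / k\<^sup>2\<close> is a gain of energies
  and both initial energies get the factor \<open>2 / k\<close>. For the norms themselves
  \<open>1 / k\<^sup>2\<close> fails if \<open>k > 1\<close>: rest with \<open>u = 0\<close>, an
  empty tank and \<open>\<epsilon> = 0\<close> force \<open>norm (F t) = norm (x_vd t) / k\<close>.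
  Measurability of \<open>F\<close> is assumed since the balance fixes only its norm.\<close>

theorem proposition1:
  fixes x :: "real \<Rightarrow> (real^'d) \<times> (real^'d)"
    and u F x_vd :: "real \<Rightarrow> real^'d"
    and E \<epsilon> :: "real \<Rightarrow> real"
    and k k\<^sub>v \<Delta>\<^sub>t :: real
  assumes "k > 0" and "k\<^sub>v > 0" and "\<Delta>\<^sub>t > 0"
    and "solves_ode x (\<lambda>t. double_integrator (x t) (u t))"
    and "solves_ode E \<epsilon>"
    and "F \<in> borel_measurable (lebesgue_on {0..})"
    and "\<And>t. t \<ge> 0 \<Longrightarrow>
      k / 2 * (norm (F t))\<^sup>2 + \<epsilon> t = 1 / (2 * k) * (norm (x_vd t))\<^sup>2 - storage_rate k\<^sub>v (u t) (x t)"
    and "\<And>t. t \<ge> 0 \<Longrightarrow> \<epsilon> t \<ge> - E t / \<Delta>\<^sub>t"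
  shows "has_L2_energy_gain x_vd F (1 / k\<^sup>2) (2 / k * (storage k\<^sub>v (x 0) + E 0)) \<and>
         has_L2_gain x_vd F (1 / k) (sqrt (2 / k * max 0 (storage k\<^sub>v (x 0) + E 0)))"
proof
  let ?W = "\<lambda>t. storage k\<^sub>v (x t) + E t"
  let ?J = "integral\<^sup>L (lebesgue_on {0..}) (\<lambda>t. (norm (x_vd t))\<^sup>2)"
  let ?b = "\<lambda>n. 1 / k\<^sup>2 * ?J + 2 / k * (?W 0 - E 0 * exp (- real n / \<Delta>\<^sub>t))"
  have W_ode: "solves_ode ?W (\<lambda>t. storage_rate k\<^sub>v (u t) (x t) + \<epsilon> t)"
    by (rule solves_ode_add[OF solves_ode_storage[OF assms(4)] assms(5)])
  have "L2_signal F \<and> (L2_norm F)\<^sup>2 \<le> 1 / k\<^sup>2 * (L2_norm x_vd)\<^sup>2 + 2 / k * ?W 0"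
    if "L2_signal x_vd"
  proof -
    have int: "integrable (lebesgue_on {0..}) (\<lambda>t. (norm (x_vd t))\<^sup>2)"
      using that unfolding L2_signal_def by blast
    then have abs_int: "(\<lambda>t. (norm (x_vd t))\<^sup>2) absolutely_integrable_on {0..}"
      by (simp add: integrable_restrict_space set_integrable_def)
    have vd_int: "(\<lambda>t. (norm (x_vd t))\<^sup>2) integrable_on {0..real n}" for n
      by (rule set_lebesgue_integral_eq_integral(1), rule set_integrable_subset[OF abs_int]) auto
    have vd_le: "integral {0..real n} (\<lambda>t. (norm (x_vd t))\<^sup>2) \<le> ?J" for n
      unfolding lebesgue_integral_eq_integral[OF int, simplified]
      by (rule integral_subset_le) (auto intro: vd_int set_lebesgue_integral_eq_integral(1)[OF abs_int])
    \<comment> \<open>Solving the balance for the squared norm of \<open>F\<close> exhibits it as a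
      combination of integrable functions, so its local integrability is derived.\<close>
    have F_has: "((\<lambda>t. (norm (F t))\<^sup>2) has_integral
        1 / k\<^sup>2 * integral {0..real n} (\<lambda>t. (norm (x_vd t))\<^sup>2) - 2 / k * (?W (real n) - ?W 0))
        {0..real n}" for n
    proof -
      have "((\<lambda>t. 1 / k\<^sup>2 * (norm (x_vd t))\<^sup>2 - 2 / k * (storage_rate k\<^sub>v (u t) (x t) + \<epsilon> t))
          has_integral 1 / k\<^sup>2 * integral {0..real n} (\<lambda>t. (norm (x_vd t))\<^sup>2)
            - 2 / k * (?W (real n) - ?W 0)) {0..real n}"
        by (intro has_integral_diff has_integral_mult_right integrable_integral vd_int
            solves_ode_has_integral[OF W_ode]) simp
      moreover have "1 / k\<^sup>2 * (norm (x_vd t))\<^sup>2 - 2 / k * (storage_rate k\<^sub>v (u t) (x t) + \<epsilon> t)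
          = (norm (F t))\<^sup>2" if "t \<in> {0..real n}" for t
      proof -
        have "storage_rate k\<^sub>v (u t) (x t) + \<epsilon> t = 1 / (2 * k) * (norm (x_vd t))\<^sup>2 - k / 2 * (norm (F t))\<^sup>2"
          using assms(7)[of t] that by simp
        then show ?thesis
          using assms(1) by (simp only:) (simp add: field_simps power2_eq_square)
      qed
      ultimately show ?thesis
        by (rule has_integral_eq[rotated])
    qed
    have F_le: "integral {0..real n} (\<lambda>t. (norm (F t))\<^sup>2) \<le> ?b n" for n
    proof -
      \<comment> \<open>The final energy \<open>?W (real n)\<close> is bounded below by the tank
        bound alone, its kinetic part being nonnegative.\<close>
      have "E 0 * exp (- real n / \<Delta>\<^sub>t) \<le> E (real n)"
        using energy_tank_lower_bound[OF assms(5) assms(8)] by simp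
      moreover have "0 \<le> storage k\<^sub>v (x (real n))"
        using assms(2) by (simp add: storage_def)
      ultimately have "2 / k * (?W 0 - ?W (real n)) \<le> 2 / k * (?W 0 - E 0 * exp (- real n / \<Delta>\<^sub>t))"
        using assms(1) by (intro mult_left_mono) auto
      moreover have "1 / k\<^sup>2 * integral {0..real n} (\<lambda>t. (norm (x_vd t))\<^sup>2) \<le> 1 / k\<^sup>2 * ?J"
        using vd_le by (intro mult_left_mono) auto
      ultimately show ?thesis
        unfolding integral_unique[OF F_has] by (simp add: algebra_simps)
    qed
    \<comment> \<open>The tank term disappears in the limit, leaving exactly
      \<open>2 / k * ?W 0\<close> as offset.\<close>
    have "(\<lambda>n. exp (- real n / \<Delta>\<^sub>t)) \<longlonglongrightarrow> 0"
      using assms(3) by real_asymp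
    then have lim: "?b \<longlonglongrightarrow> 1 / k\<^sup>2 * ?J + 2 / k * (?W 0 - E 0 * 0)"
      by (intro tendsto_intros)
    note F = integrable_half_line_nonneg[OF _ has_integral_integrable[OF F_has] F_le lim]
    show ?thesis
      using F assms(6) by (simp add: L2_signal_def L2_norm_power2)
  qed
  then show energy: "has_L2_energy_gain x_vd F (1 / k\<^sup>2) (2 / k * ?W 0)"
    unfolding has_L2_energy_gain_def by simp
  \<comment> \<open>\<open>?W 0\<close> is negative if the tank starts with a large enough debt,
    hence the cut-off under the root.\<close>
  have "has_L2_gain x_vd F (1 / k) (sqrt (max 0 (2 / k * ?W 0)))"
    using energy assms(1) by (intro L2_energy_gain_imp_L2_gain) (simp_all add: power_divide)
  moreover have "max 0 (2 / k * ?W 0) = 2 / k * max 0 (?W 0)"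
    using assms(1) by (simp add: max_mult_distrib_left)
  ultimately show "has_L2_gain x_vd F (1 / k) (sqrt (2 / k * max 0 (?W 0)))"
    by (simp only:)
qed

end
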